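(* The following problem is decidable. Input: a sentence $\alpha$ in the language of ${\sf LIN}$ expanded with finitely many unary predicate symbols such that $\alpha\vdash{\sf LIN}$. Question: does $\alpha$ have a finite model?
   Context: ${\sf LIN}$ is the first-order theory, in the signature $\{<\}$ (with identity as a logical symbol), of (strict) linear order. $\alpha\vdash{\sf LIN}$ means that $\alpha$ proves all axioms of ${\sf LIN}$. *)

theory Defs
  imports "HOL-Library.Nat_Bijection"
begin

section \<open>First-order formulas in the signature with < and unary predicates\<close>

text \<open>
  Variables are de Bruijn indices and, since the signature has no function symbols, they are
  the only terms. \<open>Pr p i\<close> is the atom in which the unary predicate symbol number \<open>p\<close> is applied
  to variable \<open>i\<close>. Falsum, implication and \<open>\<forall>\<close> are primitive; the other connectives are
  abbreviations as usual in classical logic.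
\<close>

datatype fm =
    Bot
  | Eq nat nat
  | Lt nat nat
  | Pr nat nat
  | Imp fm fm
  | All fm

abbreviation Neg :: "fm \<Rightarrow> fm" where
  "Neg \<phi> \<equiv> Imp \<phi> Bot"

abbreviation Or :: "fm \<Rightarrow> fm \<Rightarrow> fm" where
  "Or \<phi> \<psi> \<equiv> Imp (Neg \<phi>) \<psi>"

primrec fvs :: "fm \<Rightarrow> nat set" where
  "fvs Bot = {}"
| "fvs (Eq i j) = {i, j}"
| "fvs (Lt i j) = {i, j}"
| "fvs (Pr p i) = {i}"
| "fvs (Imp \<phi> \<psi>) = fvs \<phi> \<union> fvs \<psi>"
| "fvs (All \<phi>) = {i. Suc i \<in> fvs \<phi>}"

primrec preds :: "fm \<Rightarrow> nat set" where
  "preds Bot = {}"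
| "preds (Eq i j) = {}"
| "preds (Lt i j) = {}"
| "preds (Pr p i) = {p}"
| "preds (Imp \<phi> \<psi>) = preds \<phi> \<union> preds \<psi>"
| "preds (All \<phi>) = preds \<phi>"

text \<open>The sentences of the language of linear order expanded with the unary predicate symbols
  in \<open>S\<close>.\<close>

definition sentences :: "nat set \<Rightarrow> fm set" where
  "sentences S = {\<phi>. fvs \<phi> = {} \<and> preds \<phi> \<subseteq> S}"

text \<open>
  Renaming of free variables. As all terms are variables, substitution is a special case:
  \<open>inst t \<phi>\<close> replaces variable \<open>0\<close> by \<open>t\<close> and lowers the other indices, so it is the result of
  instantiating the outermost quantifier of \<open>All \<phi>\<close>.
\<close>

primrec ren :: "(nat \<Rightarrow> nat) \<Rightarrow> fm \<Rightarrow> fm" where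
  "ren \<rho> Bot = Bot"
| "ren \<rho> (Eq i j) = Eq (\<rho> i) (\<rho> j)"
| "ren \<rho> (Lt i j) = Lt (\<rho> i) (\<rho> j)"
| "ren \<rho> (Pr p i) = Pr p (\<rho> i)"
| "ren \<rho> (Imp \<phi> \<psi>) = Imp (ren \<rho> \<phi>) (ren \<rho> \<psi>)"
| "ren \<rho> (All \<phi>) = All (ren (case_nat 0 (\<lambda>i. Suc (\<rho> i))) \<phi>)"

abbreviation inst :: "nat \<Rightarrow> fm \<Rightarrow> fm" where
  "inst t \<equiv> ren (case_nat t (\<lambda>i. i))"

section \<open>Provability and the theory of strict linear order\<close>

text \<open>
  Classical natural deduction with identity. In \<open>AllI\<close> the shift \<open>ren Suc\<close> of the hypotheses makes
  variable \<open>0\<close> fresh, which is the usual eigenvariable condition.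
\<close>

inductive derives :: "fm set \<Rightarrow> fm \<Rightarrow> bool" (infix \<open>\<turnstile>\<close> 50) where
  Assm: "\<phi> \<in> \<Gamma> \<Longrightarrow> \<Gamma> \<turnstile> \<phi>"
| ImpI: "insert \<phi> \<Gamma> \<turnstile> \<psi> \<Longrightarrow> \<Gamma> \<turnstile> Imp \<phi> \<psi>"
| ImpE: "\<Gamma> \<turnstile> Imp \<phi> \<psi> \<Longrightarrow> \<Gamma> \<turnstile> \<phi> \<Longrightarrow> \<Gamma> \<turnstile> \<psi>"
| RAA: "insert (Neg \<phi>) \<Gamma> \<turnstile> Bot \<Longrightarrow> \<Gamma> \<turnstile> \<phi>"
| AllI: "ren Suc ` \<Gamma> \<turnstile> \<phi> \<Longrightarrow> \<Gamma> \<turnstile> All \<phi>"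
| AllE: "\<Gamma> \<turnstile> All \<phi> \<Longrightarrow> \<Gamma> \<turnstile> inst t \<phi>"
| EqI: "\<Gamma> \<turnstile> Eq t t"
| EqE: "\<Gamma> \<turnstile> Eq s t \<Longrightarrow> \<Gamma> \<turnstile> inst s \<phi> \<Longrightarrow> \<Gamma> \<turnstile> inst t \<phi>"

text \<open>The axioms: irreflexivity, transitivity, trichotomy.\<close>

definition LIN :: "fm set" where
  "LIN =
    {All (Neg (Lt 0 0)),
     All (All (All (Imp (Lt 2 1) (Imp (Lt 1 0) (Lt 2 0))))),
     All (All (Or (Lt 1 0) (Or (Eq 1 0) (Lt 0 1))))}"

section \<open>Finite models\<close>

record 'a struct =
  univ :: "'a set"
  lt :: "'a \<Rightarrow> 'a \<Rightarrow> bool"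
  pr :: "nat \<Rightarrow> 'a \<Rightarrow> bool"

primrec sat :: "'a struct \<Rightarrow> (nat \<Rightarrow> 'a) \<Rightarrow> fm \<Rightarrow> bool" where
  "sat M e Bot \<longleftrightarrow> False"
| "sat M e (Eq i j) \<longleftrightarrow> e i = e j"
| "sat M e (Lt i j) \<longleftrightarrow> lt M (e i) (e j)"
| "sat M e (Pr p i) \<longleftrightarrow> pr M p (e i)"
| "sat M e (Imp \<phi> \<psi>) \<longleftrightarrow> (sat M e \<phi> \<longrightarrow> sat M e \<psi>)"
| "sat M e (All \<phi>) \<longleftrightarrow> (\<forall>a\<in>univ M. sat M (case_nat a e) \<phi>)"

definition is_model :: "'a struct \<Rightarrow> fm \<Rightarrow> bool" where
  "is_model M \<phi> \<longleftrightarrow> univ M \<noteq> {} \<and> (\<forall>e. range e \<subseteq> univ M \<longrightarrow> sat M e \<phi>)"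

text \<open>
  The elements are drawn from \<open>nat\<close> because one cannot quantify over types; by
  \<open>has_finite_modelI\<close> below, a finite model with elements from any type gives such a model.
\<close>

definition has_finite_model :: "fm \<Rightarrow> bool" where
  "has_finite_model \<phi> \<longleftrightarrow> (\<exists>M :: nat struct. finite (univ M) \<and> is_model M \<phi>)"

lemma sat_transfer:
  assumes h: "bij_betw h (univ M) (univ N)"
    and lt: "\<And>a b. a \<in> univ M \<Longrightarrow> b \<in> univ M \<Longrightarrow> lt N (h a) (h b) = lt M a b"
    and pr: "\<And>p a. a \<in> univ M \<Longrightarrow> pr N p (h a) = pr M p a"
    and e: "range e \<subseteq> univ M"
  shows "sat N (h \<circ> e) \<phi> = sat M e \<phi>"
  using e
proof (induction \<phi> arbitrary: e)
  case (Eq i j)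
  then have "e i \<in> univ M" "e j \<in> univ M" by auto
  then show ?case using h by (auto simp: bij_betw_def inj_on_def)
next
  case (Lt i j)
  then have "e i \<in> univ M" "e j \<in> univ M" by auto
  then show ?case by (simp add: lt)
next
  case (Pr p i)
  then have "e i \<in> univ M" by auto
  then show ?case by (simp add: pr)
next
  case (All \<phi>)
  have "sat N (case_nat (h a) (h \<circ> e)) \<phi> = sat M (case_nat a e) \<phi>" if "a \<in> univ M" for a
  proof -
    have "range (case_nat a e) \<subseteq> univ M"
      using that All.prems by (force split: nat.splits)
    moreover have "case_nat (h a) (h \<circ> e) = h \<circ> case_nat a e"
      by (auto simp: fun_eq_iff split: nat.splits)
    ultimately show ?thesis using All.IH by metis
  qed
  moreover have "univ N = h ` univ M" using h by (simp add: bij_betw_def)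
  ultimately show ?case by (simp add: comp_def)
qed auto

lemma has_finite_modelI:
  fixes M :: "'a struct"
  assumes fin: "finite (univ M)" and M: "is_model M \<phi>"
  shows "has_finite_model \<phi>"
proof -
  obtain h :: "'a \<Rightarrow> nat" where h: "inj_on h (univ M)"
    using fin finite_imp_inj_to_nat_seg by blast
  define g where "g = inv_into (univ M) h"
  define N where "N = \<lparr>univ = h ` univ M, lt = \<lambda>x y. lt M (g x) (g y),
                      pr = \<lambda>p x. pr M p (g x)\<rparr>"
  have g: "g (h a) = a" if "a \<in> univ M" for a
    using that h by (simp add: g_def)
  have sat: "sat N (h \<circ> e) \<phi> = sat M e \<phi>" if "range e \<subseteq> univ M" for e
    using that h by (intro sat_transfer) (auto simp: N_def g bij_betw_def)
  have "sat N e \<phi>" if e: "range e \<subseteq> univ N" for e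
  proof -
    have "e i \<in> h ` univ M" for i using e by (auto simp: N_def)
    then have "range (g \<circ> e) \<subseteq> univ M" and "e = h \<circ> (g \<circ> e)"
      by (auto simp: fun_eq_iff g_def inv_into_into f_inv_into_f)
    then show ?thesis using sat M unfolding is_model_def by metis
  qed
  then have "is_model N \<phi>" using M by (auto simp: is_model_def N_def)
  moreover have "finite (univ N)" using fin by (simp add: N_def)
  ultimately show ?thesis by (auto simp: has_finite_model_def)
qed

section \<open>Decidability\<close>

text \<open>
  Programs for the partial recursive functions, and their graph: \<open>computes f xs y\<close> means that \<open>f\<close>
  halts on the arguments \<open>xs\<close> with result \<open>y\<close>. Recursion and minimisation act on the first
  argument.
\<close>

datatype recf =
    Zero
  | Succ
  | Proj nat
  | Comp recf "recf list"
  | Prec recf recf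
  | Mu recf

inductive computes :: "recf \<Rightarrow> nat list \<Rightarrow> nat \<Rightarrow> bool" where
  zero: "computes Zero xs 0"
| succ: "computes Succ [x] (Suc x)"
| proj: "i < length xs \<Longrightarrow> computes (Proj i) xs (xs ! i)"
| comp: "length ys = length gs \<Longrightarrow> (\<forall>i<length gs. computes (gs ! i) xs (ys ! i)) \<Longrightarrow>
    computes f ys z \<Longrightarrow> computes (Comp f gs) xs z"
| prec_0: "computes f xs y \<Longrightarrow> computes (Prec f g) (0 # xs) y"
| prec_Suc: "computes (Prec f g) (n # xs) y \<Longrightarrow> computes g (n # y # xs) z \<Longrightarrow>
    computes (Prec f g) (Suc n # xs) z"
| mu: "computes f (n # xs) 0 \<Longrightarrow> (\<forall>i<n. \<exists>y. computes f (i # xs) (Suc y)) \<Longrightarrow>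
    computes (Mu f) xs n"

lemma computes_unique: "computes f xs y \<Longrightarrow> computes f xs z \<Longrightarrow> y = z"
proof (induction arbitrary: z rule: computes.induct)
  case (zero xs)
  then show ?case by cases auto
next
  case (succ x)
  then show ?case by cases auto
next
  case (proj i xs)
  from proj(2) show ?case by cases auto
next
  case (comp ys gs xs f z')
  from comp.prems obtain ys' where ys': "length ys' = length gs"
    "\<forall>i<length gs. computes (gs ! i) xs (ys' ! i)" "computes f ys' z"
    by cases auto
  have "ys = ys'"
    using ys'(1,2) comp.hyps(1) comp.IH(1) by (intro nth_equalityI) auto
  then show ?case using comp.IH(2) ys'(3) by blast
next
  case (prec_0 f xs y g)
  from prec_0.prems have "computes f xs z" by cases auto
  then show ?case by (rule prec_0.IH)
next
  case (prec_Suc f g n xs y z')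
  from prec_Suc.prems obtain y' where "computes (Prec f g) (n # xs) y'" "computes g (n # y' # xs) z"
    by cases auto
  then show ?case using prec_Suc.IH by blast
next
  case (mu f n xs)
  from mu.prems have z: "computes f (z # xs) 0 \<and> (\<forall>i<z. \<exists>y. computes f (i # xs) (Suc y))"
    by cases auto
  show ?case
  proof (rule linorder_cases[of n z])
    assume "n < z"
    then obtain y where "computes f (n # xs) (Suc y)" using z by blast
    then show ?thesis using mu.IH(1) by blast
  next
    assume "z < n"
    then obtain y where "\<And>w. computes f (z # xs) w \<Longrightarrow> Suc y = w" using mu.IH(2) by blast
    then show ?thesis using z by blast
  qed
qed

text \<open>
  A problem with a set \<open>I\<close> of admissible inputs: one program has to halt with the correct answer
  on every input from \<open>I\<close>, and nothing is required of it on other inputs (\<open>I\<close> itself need not be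
  decidable).
\<close>

definition decidable_on :: "('a \<Rightarrow> nat) \<Rightarrow> 'a set \<Rightarrow> ('a \<Rightarrow> bool) \<Rightarrow> bool" where
  "decidable_on code I Q \<longleftrightarrow>
    (\<exists>f. \<forall>x\<in>I. computes f [code x] (if Q x then 1 else 0))"

primrec godel :: "fm \<Rightarrow> nat" where
  "godel Bot = prod_encode (0, 0)"
| "godel (Eq i j) = prod_encode (1, prod_encode (i, j))"
| "godel (Lt i j) = prod_encode (2, prod_encode (i, j))"
| "godel (Pr p i) = prod_encode (3, prod_encode (p, i))"
| "godel (Imp \<phi> \<psi>) = prod_encode (4, prod_encode (godel \<phi>, godel \<psi>))"
| "godel (All \<phi>) = prod_encode (5, godel \<phi>)"

lemma inj_godel: "inj godel"
proof (rule injI)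
  show "godel \<phi> = godel \<psi> \<Longrightarrow> \<phi> = \<psi>" for \<phi> \<psi>
  proof (induction \<phi> arbitrary: \<psi>)
    case Bot then show ?case by (cases \<psi>) auto
  next
    case (Eq i j) then show ?case by (cases \<psi>) auto
  next
    case (Lt i j) then show ?case by (cases \<psi>) auto
  next
    case (Pr p i) then show ?case by (cases \<psi>) auto
  next
    case (Imp \<phi>1 \<phi>2) then show ?case by (cases \<psi>) auto
  next
    case (All \<phi>) then show ?case by (cases \<psi>) auto
  qed
qed

end

theory Submission
  imports Defs
begin

text \<open>
  By soundness every model of \<open>\<alpha>\<close> is a linear order, so a finite model is a word whose letters are
  sets of predicate symbols. Words of the same rank \<open>d\<close> type satisfy the same sentences of rank at
  most \<open>d\<close>, and this equivalence is a congruence with finitely many classes. If a word is longer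
  than the number of types, then two of its nonempty prefixes have the same type and the segment
  between them can be cut out. Hence \<open>\<alpha>\<close> has a finite model iff it has one of size at most a
  primitive recursive bound, and the search for it consists of bounded quantifiers only: the truth
  values of all subformulas under all assignments are guessed as one number and checked locally.
\<close>

section \<open>Closure properties of recursive functions\<close>

text \<open>
  Argument lists are presented as assignments, so that a bound variable is added by shifting
  indices; missing arguments are \<open>0\<close>.
\<close>

definition arg :: "nat list \<Rightarrow> nat \<Rightarrow> nat" where
  "arg xs i = (if i < length xs then xs ! i else 0)"

definition recursive :: "nat \<Rightarrow> ((nat \<Rightarrow> nat) \<Rightarrow> nat) \<Rightarrow> bool" where
  "recursive k F \<longleftrightarrow> (\<exists>f. \<forall>xs. length xs = k \<longrightarrow> computes f xs (F (arg xs)))"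

definition decidable :: "nat \<Rightarrow> ((nat \<Rightarrow> nat) \<Rightarrow> bool) \<Rightarrow> bool" where
  "decidable k P \<longleftrightarrow> recursive k (\<lambda>e. if P e then 1 else 0)"

lemma arg_Cons: "arg (x # xs) = case_nat x (arg xs)"
  by (auto simp: arg_def fun_eq_iff split: nat.splits)

lemma recursive_arg: "recursive k (\<lambda>e. e i)"
proof (cases "i < k")
  case True
  then show ?thesis
    unfolding recursive_def arg_def by (auto intro!: exI[of _ "Proj i"] computes.intros)
next
  case False
  then show ?thesis
    unfolding recursive_def arg_def by (auto intro!: exI[of _ Zero] computes.intros)
qed

lemma computes_Comp1:
  assumes "computes g xs y" "computes f [y] z"
  shows "computes (Comp f [g]) xs z"
  using assms by (intro computes.comp[of "[y]"]) auto

lemma recursive_Suc: "recursive k F \<Longrightarrow> recursive k (\<lambda>e. Suc (F e))"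
  unfolding recursive_def by (meson computes_Comp1 computes.succ)

lemma recursive_0: "recursive k (\<lambda>e. 0)"
  unfolding recursive_def by (auto intro!: exI[of _ Zero] computes.intros)

lemma recursive_const: "recursive k (\<lambda>e. c)"
  by (induction c) (auto intro: recursive_0 recursive_Suc)

lemma recursive_rec_nat:
  assumes "recursive k G"
    and "recursive (Suc (Suc k)) (\<lambda>e. H (e 0) (e (Suc 0)) (\<lambda>i. e (Suc (Suc i))))"
    and "recursive k F"
  shows "recursive k (\<lambda>e. rec_nat (G e) (\<lambda>n y. H n y e) (F e))"
proof -
  obtain g h f where g: "\<And>xs. length xs = k \<Longrightarrow> computes g xs (G (arg xs))"
    and h: "\<And>xs. length xs = Suc (Suc k) \<Longrightarrow>
      computes h xs (H (arg xs 0) (arg xs (Suc 0)) (\<lambda>i. arg xs (Suc (Suc i))))"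
    and f: "\<And>xs. length xs = k \<Longrightarrow> computes f xs (F (arg xs))"
    using assms unfolding recursive_def by metis
  have prec: "computes (Prec g h) (n # xs) (rec_nat (G (arg xs)) (\<lambda>n y. H n y (arg xs)) n)"
    if "length xs = k" for xs n
  proof (induction n)
    case 0
    then show ?case using g that by (auto intro: computes.intros)
  next
    case (Suc n)
    let ?y = "rec_nat (G (arg xs)) (\<lambda>n y. H n y (arg xs)) n"
    have "computes h (n # ?y # xs) (H n ?y (arg xs))"
      using h[of "n # ?y # xs"] that by (simp add: arg_Cons)
    with Suc show ?case by (auto intro: computes.intros)
  qed
  \<comment> \<open>\<open>Prec\<close> recurses on its first argument, so the value of
    \<open>F\<close> is put in front and projections copy the original arguments behind it.\<close>
  have "computes (Comp (Prec g h) (f # map Proj [0..<k])) xs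
      (rec_nat (G (arg xs)) (\<lambda>n y. H n y (arg xs)) (F (arg xs)))" if "length xs = k" for xs
  proof (rule computes.comp)
    show "\<forall>i<length (f # map Proj [0..<k]).
        computes ((f # map Proj [0..<k]) ! i) xs ((F (arg xs) # xs) ! i)"
      using f that by (auto simp: nth_Cons split: nat.splits intro: computes.intros)
  qed (use that prec in auto)
  then show ?thesis unfolding recursive_def by blast
qed

text \<open>Reduces a binary operation to the case where its operands are the variables 0 and 1;
  arbitrary operands \<open>F\<close> and \<open>G\<close> are then supplied by composition.\<close>

lemma recursive_comp2:
  assumes "recursive (Suc (Suc 0)) (\<lambda>e. f (e 0) (e (Suc 0)))" "recursive k F" "recursive k G"
  shows "recursive k (\<lambda>e. f (F e) (G e))"
proof -
  obtain h hF hG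
    where h: "\<And>xs. length xs = Suc (Suc 0) \<Longrightarrow> computes h xs (f (arg xs 0) (arg xs (Suc 0)))"
    and F: "\<And>xs. length xs = k \<Longrightarrow> computes hF xs (F (arg xs))"
    and G: "\<And>xs. length xs = k \<Longrightarrow> computes hG xs (G (arg xs))"
    using assms unfolding recursive_def by metis
  have "computes (Comp h [hF, hG]) xs (f (F (arg xs)) (G (arg xs)))" if "length xs = k" for xs
  proof (rule computes.comp[of "[F (arg xs), G (arg xs)]"])
    show "computes h [F (arg xs), G (arg xs)] (f (F (arg xs)) (G (arg xs)))"
      using h[of "[F (arg xs), G (arg xs)]"] by (simp add: arg_Cons)
  qed (use F G that in \<open>auto simp: nth_Cons split: nat.splits\<close>)
  then show ?thesis unfolding recursive_def by blast
qed

lemma recursive_comp1: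
  assumes "recursive (Suc (Suc 0)) (\<lambda>e. f (e 0))" "recursive k F"
  shows "recursive k (\<lambda>e. f (F e))"
  using recursive_comp2[of "\<lambda>x y. f x" k F F] assms by simp

text \<open>\<open>F\<close> reads every variable from \<open>k\<close> on as 0. Such a variable
  must be sent to some index from \<open>l\<close> on, where the new argument list also yields
  0.\<close>

lemma recursive_rename:
  assumes "recursive k F" and \<rho>: "\<And>i. k \<le> i \<Longrightarrow> l \<le> \<rho> i"
  shows "recursive l (\<lambda>e. F (\<lambda>i. e (\<rho> i)))"
proof -
  have "\<exists>f. \<forall>xs. length xs = l \<longrightarrow> computes f xs (arg xs (\<rho> i))" for i
    using recursive_arg[of l "\<rho> i"] by (simp add: recursive_def)
  then obtain f where f: "\<And>i xs. length xs = l \<Longrightarrow> computes (f i) xs (arg xs (\<rho> i))"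
    by metis
  obtain h where h: "\<And>xs. length xs = k \<Longrightarrow> computes h xs (F (arg xs))"
    using assms(1) unfolding recursive_def by metis
  have "computes (Comp h (map f [0..<k])) xs (F (\<lambda>i. arg xs (\<rho> i)))" if xs: "length xs = l" for xs
  proof (rule computes.comp)
    let ?ys = "map (\<lambda>i. arg xs (\<rho> i)) [0..<k]"
    have "arg ?ys i = arg xs (\<rho> i)" for i
      using \<rho>[of i] xs by (cases "i < k") (auto simp: arg_def)
    then have "arg ?ys = (\<lambda>i. arg xs (\<rho> i))" ..
    then show "computes h ?ys (F (\<lambda>i. arg xs (\<rho> i)))"
      using h[of ?ys] by simp
  qed (use f xs in auto)
  then show ?thesis unfolding recursive_def by blast
qed

section \<open>Arithmetic by primitive recursion\<close>

named_theorems recursive_intros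

lemmas [recursive_intros] = recursive_arg recursive_const recursive_Suc recursive_rec_nat

lemma recursive_add [recursive_intros]:
  assumes "recursive k F" "recursive k G"
  shows "recursive k (\<lambda>e. F e + G e)"
proof (rule recursive_comp2[OF _ assms])
  have "m + n = rec_nat m (\<lambda>_ y. Suc y) n" for m n :: nat by (induction n) auto
  then show "recursive (Suc (Suc 0)) (\<lambda>e. e 0 + e (Suc 0))"
    by (simp only:) (intro recursive_intros)
qed

lemma recursive_mult [recursive_intros]:
  assumes "recursive k F" "recursive k G"
  shows "recursive k (\<lambda>e. F e * G e)"
proof (rule recursive_comp2[OF _ assms])
  have "m * n = rec_nat 0 (\<lambda>_ y. y + m) n" for m n :: nat by (induction n) auto
  then show "recursive (Suc (Suc 0)) (\<lambda>e. e 0 * e (Suc 0))"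
    by (simp only:) (intro recursive_intros)
qed

lemma recursive_power [recursive_intros]:
  assumes "recursive k F" "recursive k G"
  shows "recursive k (\<lambda>e. F e ^ G e)"
proof (rule recursive_comp2[OF _ assms])
  have "m ^ n = rec_nat 1 (\<lambda>_ y. y * m) n" for m n :: nat by (induction n) auto
  then show "recursive (Suc (Suc 0)) (\<lambda>e. e 0 ^ e (Suc 0))"
    by (simp only:) (intro recursive_intros)
qed

lemma recursive_pred:
  assumes "recursive k F"
  shows "recursive k (\<lambda>e. F e - 1)"
proof (rule recursive_comp1[OF _ assms])
  have "n - 1 = rec_nat 0 (\<lambda>x _. x) n" for n :: nat by (induction n) auto
  then show "recursive (Suc (Suc 0)) (\<lambda>e. e 0 - 1)"
    by (simp only:) (intro recursive_intros)
qed

lemma recursive_diff [recursive_intros]: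
  assumes "recursive k F" "recursive k G"
  shows "recursive k (\<lambda>e. F e - G e)"
proof (rule recursive_comp2[OF _ assms])
  \<comment> \<open>The step function itself contains a subtraction, so using this equation from
    right to left as a rewrite rule would loop.\<close>
  have "rec_nat m (\<lambda>_ y. y - 1) n = m - n" for m n :: nat by (induction n) auto
  moreover have "recursive (Suc (Suc 0)) (\<lambda>e. rec_nat (e 0) (\<lambda>_ y. y - 1) (e (Suc 0)))"
    by (intro recursive_intros recursive_pred)
  ultimately show "recursive (Suc (Suc 0)) (\<lambda>e. e 0 - e (Suc 0))" by simp
qed

lemma recursive_prod_encode [recursive_intros]:
  assumes "recursive k F" "recursive k G"
  shows "recursive k (\<lambda>e. prod_encode (F e, G e))"
proof (rule recursive_comp2[OF _ assms])
  have "triangle n = rec_nat 0 (\<lambda>x y. y + Suc x) n" for n by (induction n) auto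
  then show "recursive (Suc (Suc 0)) (\<lambda>e. prod_encode (e 0, e (Suc 0)))"
    by (simp only: prod_encode_def prod.case) (intro recursive_intros)
qed

section \<open>Case distinction, connectives and bounded quantifiers\<close>

lemma recursive_If [recursive_intros]:
  assumes "decidable k P" "recursive k F" "recursive k G"
  shows "recursive k (\<lambda>e. if P e then F e else G e)"
proof -
  define c where "c e = (if P e then 1 else 0 :: nat)" for e
  have "recursive k c" using assms(1) by (simp add: decidable_def c_def[abs_def])
  then have "recursive k (\<lambda>e. F e * c e + G e * (1 - c e))"
    using assms(2,3) by (intro recursive_intros)
  then show ?thesis by (rule back_subst[of "recursive k"]) (simp add: c_def fun_eq_iff)
qed

lemma decidable_less [recursive_intros]:
  assumes "recursive k F" "recursive k G"
  shows "decidable k (\<lambda>e. F e < G e)"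
proof -
  \<comment> \<open>With truncated subtraction, \<open>Suc (F e) - G e\<close> vanishes exactly when
    \<open>F e < G e\<close>.\<close>
  have "recursive k (\<lambda>e. 1 - (Suc (F e) - G e))"
    using assms by (intro recursive_intros)
  then show ?thesis
    unfolding decidable_def by (rule back_subst[of "recursive k"]) (auto simp: fun_eq_iff)
qed

lemma decidable_not [recursive_intros]:
  assumes "decidable k P"
  shows "decidable k (\<lambda>e. \<not> P e)"
proof -
  have "recursive k (\<lambda>e. if P e then 0 else 1)"
    using assms by (intro recursive_intros)
  then show ?thesis
    unfolding decidable_def by (rule back_subst[of "recursive k"]) (simp add: fun_eq_iff)
qed

lemma decidable_conj [recursive_intros]:
  assumes "decidable k P" "decidable k Q"
  shows "decidable k (\<lambda>e. P e \<and> Q e)"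
proof -
  have "recursive k (\<lambda>e. if P e then if Q e then 1 else 0 else 0)"
    using assms by (intro recursive_intros)
  then show ?thesis
    unfolding decidable_def by (rule back_subst[of "recursive k"]) (simp add: fun_eq_iff)
qed

lemma decidable_imp [recursive_intros]:
  assumes "decidable k P" "decidable k Q"
  shows "decidable k (\<lambda>e. P e \<longrightarrow> Q e)"
proof -
  have "(\<lambda>e. P e \<longrightarrow> Q e) = (\<lambda>e. \<not> (P e \<and> \<not> Q e))" by auto
  then show ?thesis using assms by (simp only:) (intro recursive_intros)
qed

lemma decidable_iff [recursive_intros]:
  assumes "decidable k P" "decidable k Q"
  shows "decidable k (\<lambda>e. P e \<longleftrightarrow> Q e)"
  unfolding iff_conv_conj_imp using assms by (intro recursive_intros)

lemma decidable_eq [recursive_intros]: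
  assumes "recursive k F" "recursive k G"
  shows "decidable k (\<lambda>e. F e = G e)"
proof -
  have "(\<lambda>e. F e = G e) = (\<lambda>e. \<not> F e < G e \<and> \<not> G e < F e)" by auto
  then show ?thesis using assms by (simp only:) (intro recursive_intros)
qed

lemma decidable_bex [recursive_intros]:
  assumes "recursive k B" "decidable (Suc k) (\<lambda>e. P (e 0) (\<lambda>i. e (Suc i)))"
  shows "decidable k (\<lambda>e. \<exists>n<B e. P n e)"
proof -
  \<comment> \<open>In the recursion, variable 0 is the counter and variable 1 the accumulator.
    \<open>P\<close> sees the counter and the parameters, so the renaming skips variable 1.\<close>
  have "recursive (Suc (Suc k)) (\<lambda>e. if P (e 0) (\<lambda>i. e (Suc (Suc i))) then 1 else e (Suc 0))"
    using recursive_rename[OF assms(2)[unfolded decidable_def],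
        where \<rho> = "case_nat 0 (\<lambda>i. Suc (Suc i))" and l = "Suc (Suc k)"]
    by (intro recursive_intros) (simp add: decidable_def split: nat.splits)
  then have "recursive k (\<lambda>e. rec_nat 0 (\<lambda>n y. if P n e then 1 else y) (B e))"
    using assms(1) by (intro recursive_rec_nat recursive_const)
  moreover have "rec_nat 0 (\<lambda>n y. if P n e then 1 else y) b = (if \<exists>n<b. P n e then 1 else 0)"
    for e b
    by (induction b) (auto simp: less_Suc_eq)
  then have "(\<lambda>e. rec_nat 0 (\<lambda>n y. if P n e then 1 else y) (B e)) =
      (\<lambda>e. if \<exists>n<B e. P n e then 1 else 0)"
    by (intro ext)
  ultimately show ?thesis unfolding decidable_def by (rule back_subst[of "recursive k"])
qed

lemma decidable_ball [recursive_intros]: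
  assumes "recursive k B" "decidable (Suc k) (\<lambda>e. P (e 0) (\<lambda>i. e (Suc i)))"
  shows "decidable k (\<lambda>e. \<forall>n<B e. P n e)"
proof -
  have "(\<lambda>e. \<forall>n<B e. P n e) = (\<lambda>e. \<not> (\<exists>n<B e. \<not> P n e))" by auto
  then show ?thesis using assms by (simp only:) (intro recursive_intros)
qed

lemma recursive_div [recursive_intros]:
  assumes "recursive k F" "recursive k G"
  shows "recursive k (\<lambda>e. F e div G e)"
proof (rule recursive_comp2[OF _ assms])
  have *: "m div n = (if n = 0 then 0 else rec_nat 0 (\<lambda>q y. if m < Suc q * n then y else Suc q) m)"
    for m n :: nat
  proof (cases "n = 0")
    case False
    \<comment> \<open>After \<open>l\<close> rounds the accumulator is the largest candidate up to
      \<open>l\<close> whose product with \<open>n\<close> does not exceed \<open>m\<close>. The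
      quotient is at most \<open>m\<close>, so \<open>m\<close> rounds suffice; division by 0 yields
      0 and is treated apart.\<close>
    have "rec_nat 0 (\<lambda>q y. if m < Suc q * n then y else Suc q) l = min l (m div n)" for l
    proof (induction l)
      case (Suc l)
      have "m < Suc l * n \<longleftrightarrow> m div n < Suc l"
        using False by (simp add: div_less_iff_less_mult)
      with Suc show ?case by simp
    qed simp
    from this[of m] False show ?thesis by (simp del: mult_Suc)
  qed simp
  show "recursive (Suc (Suc 0)) (\<lambda>e. e 0 div e (Suc 0))"
    unfolding * by (intro recursive_intros)
qed

lemma recursive_mod [recursive_intros]:
  assumes "recursive k F" "recursive k G"
  shows "recursive k (\<lambda>e. F e mod G e)"
  unfolding modulo_nat_def using assms by (intro recursive_intros)

lemma decidable_set_decode [recursive_intros]: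
  assumes "recursive k F" "recursive k G"
  shows "decidable k (\<lambda>e. F e \<in> set_decode (G e))"
  unfolding set_decode_def mem_Collect_eq odd_iff_mod_2_eq_one
  using assms by (intro recursive_intros)


section \<open>Words up to rank \<open>d\<close> equivalence\<close>

text \<open>An Ehrenfeucht-Fraisse game with \<open>d\<close> rounds. A move picks a position, that
  is, a split around a letter; the answer must have the same letter, and the game goes on separately
  to the left and to the right of it.\<close>

primrec eqv :: "nat \<Rightarrow> 'a list \<Rightarrow> 'a list \<Rightarrow> bool" where
  "eqv 0 w v \<longleftrightarrow> True"
| "eqv (Suc d) w v \<longleftrightarrow>
    (\<forall>x a y. w = x @ a # y \<longrightarrow> (\<exists>x' y'. v = x' @ a # y' \<and> eqv d x x' \<and> eqv d y y')) \<and>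
    (\<forall>x a y. v = x @ a # y \<longrightarrow> (\<exists>x' y'. w = x' @ a # y' \<and> eqv d x' x \<and> eqv d y' y))"

lemma eqv_refl: "eqv d w w"
  by (induction d arbitrary: w) auto

lemma eqv_splitE1:
  assumes "eqv (Suc d) w v" "w = x @ a # y"
  obtains x' y' where "v = x' @ a # y'" "eqv d x x'" "eqv d y y'"
  using assms unfolding eqv.simps by blast

lemma eqv_splitE2:
  assumes "eqv (Suc d) w v" "v = x @ a # y"
  obtains x' y' where "w = x' @ a # y'" "eqv d x' x" "eqv d y' y"
  using assms unfolding eqv.simps by blast

lemma eqv_sym: "eqv d w v \<Longrightarrow> eqv d v w"
proof (induction d arbitrary: w v)
  case (Suc d)
  show ?case
    unfolding eqv.simps
  proof (intro conjI allI impI)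
    fix x a y assume "v = x @ a # y"
    with Suc.prems obtain x' y' where "w = x' @ a # y'" "eqv d x' x" "eqv d y' y"
      by (rule eqv_splitE2)
    with Suc.IH show "\<exists>x' y'. w = x' @ a # y' \<and> eqv d x x' \<and> eqv d y y'" by blast
  next
    fix x a y assume "w = x @ a # y"
    with Suc.prems obtain x' y' where "v = x' @ a # y'" "eqv d x x'" "eqv d y y'"
      by (rule eqv_splitE1)
    with Suc.IH show "\<exists>x' y'. v = x' @ a # y' \<and> eqv d x' x \<and> eqv d y' y" by blast
  qed
qed simp

text \<open>By symmetry both premises have the same shape, so that one auxiliary fact, used in both
  directions, proves an equivalence.\<close>

lemma eqv_SucI:
  assumes 1: "\<And>x a y. w = x @ a # y \<Longrightarrow> \<exists>x' y'. v = x' @ a # y' \<and> eqv d x x' \<and> eqv d y y'"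
    and 2: "\<And>x a y. v = x @ a # y \<Longrightarrow> \<exists>x' y'. w = x' @ a # y' \<and> eqv d x x' \<and> eqv d y y'"
  shows "eqv (Suc d) w v"
  unfolding eqv.simps
proof (intro conjI allI impI)
  fix x a y assume "v = x @ a # y"
  from 2[OF this] obtain x' y' where w: "w = x' @ a # y'" and x: "eqv d x x'" and y: "eqv d y y'"
    by blast
  show "\<exists>x' y'. w = x' @ a # y' \<and> eqv d x' x \<and> eqv d y' y"
    using w eqv_sym[OF x] eqv_sym[OF y] by blast
qed (rule 1)

lemma eqv_SucD: "eqv (Suc d) w v \<Longrightarrow> eqv d w v"
proof (induction d arbitrary: w v)
  case (Suc d)
  show ?case
  proof (rule eqv_SucI)
    fix x a y assume "w = x @ a # y"
    with Suc.prems obtain x' y' where "v = x' @ a # y'" "eqv (Suc d) x x'" "eqv (Suc d) y y'"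
      by (rule eqv_splitE1)
    with Suc.IH show "\<exists>x' y'. v = x' @ a # y' \<and> eqv d x x' \<and> eqv d y y'" by blast
  next
    fix x a y assume "v = x @ a # y"
    with eqv_sym[OF Suc.prems] obtain x' y' where "w = x' @ a # y'" "eqv (Suc d) x x'" "eqv (Suc d) y y'"
      by (rule eqv_splitE1)
    with Suc.IH show "\<exists>x' y'. w = x' @ a # y' \<and> eqv d x x' \<and> eqv d y y'" by blast
  qed
qed simp

lemma append_eq_append_ConsE:
  assumes "u @ v = x @ a # y"
  obtains (left) y' where "u = x @ a # y'" "y = y' @ v"
  | (right) x' where "v = x' @ a # y" "x = u @ x'"
proof -
  from assms obtain us where "u = x @ us \<and> us @ v = a # y \<or> u @ us = x \<and> v = us @ a # y"
    unfolding append_eq_append_conv2[of u v x "a # y"] ..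
  then consider "u = x @ us" "us @ v = a # y" | "x = u @ us" "v = us @ a # y"
    by (elim disjE conjE) simp_all
  then show thesis
  proof cases
    case 1
    show thesis
    proof (cases us)
      case Nil
      with 1 have "v = [] @ a # y" "x = u @ []" by simp_all
      then show thesis by (rule right)
    next
      case (Cons b us')
      with 1 have "u = x @ a # us'" "y = us' @ v" by simp_all
      then show thesis by (rule left)
    qed
  next
    case 2
    from 2(2,1) show thesis by (rule right)
  qed
qed

text \<open>A move in a concatenation falls into one of the two factors and is answered there. The
  other factor stays whole and merely gives up a round, by \<open>eqv_SucD\<close>.\<close>

lemma eqv_append: "eqv d u u' \<Longrightarrow> eqv d v v' \<Longrightarrow> eqv d (u @ v) (u' @ v')"
proof (induction d arbitrary: u u' v v')
  case (Suc d)
  have *: "\<exists>x' y'. u' @ v' = x' @ a # y' \<and> eqv d x x' \<and> eqv d y y'"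
    if u: "eqv (Suc d) u u'" and v: "eqv (Suc d) v v'" and eq: "u @ v = x @ a # y"
    for u u' v v' x a and y :: "'a list"
    using eq
  proof (cases rule: append_eq_append_ConsE)
    case (left z)
    from u left(1) obtain x' z' where "u' = x' @ a # z'" "eqv d x x'" "eqv d z z'"
      by (rule eqv_splitE1)
    with left Suc.IH[of z z' v v'] eqv_SucD[OF v] show ?thesis
      by (intro exI[of _ x'] exI[of _ "z' @ v'"]) simp
  next
    case (right z)
    from v right(1) obtain z' y' where "v' = z' @ a # y'" "eqv d z z'" "eqv d y y'"
      by (rule eqv_splitE1)
    with right Suc.IH[of u u' z z'] eqv_SucD[OF u] show ?thesis
      by (intro exI[of _ "u' @ z'"] exI[of _ y']) simp
  qed
  show ?case
    by (rule eqv_SucI[OF *[OF Suc.prems] *[OF Suc.prems[THEN eqv_sym]]])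
qed simp

lemma eqv_map: "eqv d w v \<Longrightarrow> eqv d (map f w) (map f v)"
proof (induction d arbitrary: w v)
  case (Suc d)
  have *: "\<exists>x' y'. map f v = x' @ a # y' \<and> eqv d x x' \<and> eqv d y y'"
    if wv: "eqv (Suc d) w v" and w: "map f w = x @ a # y" for w v x a y
  proof -
    obtain p b q where "w = p @ b # q" "map f p = x" "f b = a" "map f q = y"
      using w by (auto simp: map_eq_append_conv map_eq_Cons_conv)
    moreover from wv this(1) obtain p' q' where "v = p' @ b # q'" "eqv d p p'" "eqv d q q'"
      by (rule eqv_splitE1)
    ultimately show ?thesis
      using Suc.IH[of p p'] Suc.IH[of q q']
      by (intro exI[of _ "map f p'"] exI[of _ "map f q'"]) simp
  qed
  show ?case
    by (rule eqv_SucI[OF *[OF Suc.prems] *[OF Suc.prems[THEN eqv_sym]]])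
qed simp

text \<open>An invariant finer than \<open>eqv d\<close> whose values are easily bounded.\<close>

primrec tp :: "nat \<Rightarrow> nat list \<Rightarrow> nat" where
  "tp 0 w = 0"
| "tp (Suc d) w = set_encode {prod_encode (tp d x, prod_encode (a, tp d y)) | x a y. w = x @ a # y}"

text \<open>Needed because \<open>set_encode\<close> is injective on finite sets only. A split is
  determined by its position.\<close>

lemma finite_splits: "finite {f x a y | x a y. w = x @ a # y}"
proof (rule finite_subset)
  show "{f x a y | x a y. w = x @ a # y} \<subseteq>
      (\<lambda>i. f (take i w) (w ! i) (drop (Suc i) w)) ` {..<length w}"
  proof
    fix t assume "t \<in> {f x a y | x a y. w = x @ a # y}"
    then obtain x a y where "t = f x a y" "w = x @ a # y" by blast
    then show "t \<in> (\<lambda>i. f (take i w) (w ! i) (drop (Suc i) w)) ` {..<length w}"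
      by (intro image_eqI[of _ _ "length x"]) auto
  qed
qed simp

lemma eqv_if_tp_eq: "tp d w = tp d v \<Longrightarrow> eqv d w v"
proof (induction d arbitrary: w v)
  case (Suc d)
  have *: "\<exists>x' y'. v = x' @ a # y' \<and> eqv d x x' \<and> eqv d y y'"
    if "tp (Suc d) w = tp (Suc d) v" "w = x @ a # y" for w v x a y
  proof -
    have "{prod_encode (tp d x, prod_encode (a, tp d y)) | x a y. w = x @ a # y} =
        {prod_encode (tp d x, prod_encode (a, tp d y)) | x a y. v = x @ a # y}"
      using that(1) by (simp add: set_encode_eq finite_splits)
    with that(2) obtain x' b y' where "v = x' @ b # y'"
      "prod_encode (tp d x, prod_encode (a, tp d y)) =
        prod_encode (tp d x', prod_encode (b, tp d y'))"
      by blast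
    then show ?thesis using Suc.IH by auto
  qed
  show ?case
    by (rule eqv_SucI[OF *[OF Suc.prems] *[OF Suc.prems[symmetric]]])
qed simp

section \<open>Bounding the types and shortening words\<close>

lemma prod_encode_mono:
  assumes "a \<le> c" "b \<le> d"
  shows "prod_encode (a, b) \<le> prod_encode (c, d)"
proof -
  have "mono triangle" by (intro mono_iff_le_Suc[THEN iffD2]) simp
  then have "triangle (a + b) \<le> triangle (c + d)" by (rule monoD) (use assms in simp)
  with assms show ?thesis by (simp add: prod_encode_def)
qed

lemma set_encode_less:
  assumes "A \<subseteq> {..<n}"
  shows "set_encode A < 2 ^ n"
proof -
  have "set_encode A \<le> set_encode {..<n}"
    using assms unfolding set_encode_def by (intro sum_mono2) auto
  also have "\<dots> < 2 ^ n" by (induction n) (auto simp: lessThan_Suc)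
  finally show ?thesis .
qed

text \<open>The recursion copies that of \<open>tp\<close>: if the types of lower rank are below
  \<open>N\<close> and the letters below \<open>A\<close>, each coded triple is at most the code of
  \<open>N\<close>, \<open>A\<close>, \<open>N\<close>, and a set of such numbers has a code below
  this power of two.\<close>

definition tp_bound :: "nat \<Rightarrow> nat \<Rightarrow> nat" where
  "tp_bound A = rec_nat 1 (\<lambda>_ N. 2 ^ Suc (prod_encode (N, prod_encode (A, N))))"

lemma tp_less_bound: "set w \<subseteq> {..<A} \<Longrightarrow> tp d w < tp_bound A d"
proof (induction d arbitrary: w)
  case (Suc d)
  have "prod_encode (tp d x, prod_encode (a, tp d y)) \<le>
      prod_encode (tp_bound A d, prod_encode (A, tp_bound A d))" if "w = x @ a # y" for x a y
    using that Suc.prems Suc.IH[of x] Suc.IH[of y] by (intro prod_encode_mono) auto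
  then have "tp (Suc d) w < 2 ^ Suc (prod_encode (tp_bound A d, prod_encode (A, tp_bound A d)))"
    unfolding tp.simps by (intro set_encode_less) (auto simp: less_Suc_eq_le)
  then show ?case by (simp add: tp_bound_def)
qed (simp add: tp_bound_def)

lemma ex_shorter_eqv:
  assumes "set w \<subseteq> {..<A}" and long: "tp_bound A d < length w"
  shows "\<exists>v. v \<noteq> [] \<and> length v < length w \<and> set v \<subseteq> set w \<and> eqv d w v"
proof -
  let ?f = "\<lambda>i. tp d (take i w)"
  \<comment> \<open>Prefixes start at length 1, so that at least one letter survives the
    cut.\<close>
  have "?f ` {1..length w} \<subseteq> {..<tp_bound A d}"
    using assms(1) by (auto intro!: tp_less_bound dest: in_set_takeD)
  then have "card (?f ` {1..length w}) < card {1..length w}"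
    using long card_mono[of "{..<tp_bound A d}" "?f ` {1..length w}"] by simp
  then have "\<not> inj_on ?f {1..length w}" by (rule pigeonhole)
  then obtain k l where kl: "k \<in> {1..length w}" "l \<in> {1..length w}" "k \<noteq> l" "?f k = ?f l"
    unfolding inj_on_def by blast
  define i j where "i = min k l" and "j = max k l"
  then have ij: "1 \<le> i" "i < j" "j \<le> length w" "?f i = ?f j"
    using kl by (auto simp: min_def max_def)
  let ?v = "take i w @ drop j w"
  \<comment> \<open>Only the prefix of length \<open>j\<close> is exchanged; the congruence extends
    the equivalence to the common suffix.\<close>
  have "eqv d (take j w @ drop j w) ?v"
    by (intro eqv_append eqv_refl eqv_if_tp_eq) (rule ij(4)[symmetric])
  then have "eqv d w ?v" by simp
  moreover have "set ?v \<subseteq> set w" by (auto dest: in_set_takeD in_set_dropD)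
  moreover have "?v \<noteq> []" "length ?v < length w" using ij(1-3) by auto
  ultimately show ?thesis by blast
qed

section \<open>Satisfaction in words\<close>

text \<open>A letter carries its predicates and the variables whose value is its position.\<close>

definition shift_marks :: "nat set \<times> nat set \<Rightarrow> nat set \<times> nat set" where
  "shift_marks = apsnd ((`) Suc)"

text \<open>The counterpart of \<open>case_nat a e\<close>: the older variables move up by one index
  and the chosen position receives the new variable 0.\<close>

definition mark :: "nat \<Rightarrow> (nat set \<times> nat set) list \<Rightarrow> (nat set \<times> nat set) list" where
  "mark i w = (map shift_marks w)[i := apsnd (insert 0) (shift_marks (w ! i))]"

text \<open>Satisfaction without an assignment, whose values are read off the marks. As the word is
  the only parameter, invariance under \<open>eqv\<close> can be shown by induction on
  formulas.\<close>

primrec wsat :: "(nat set \<times> nat set) list \<Rightarrow> fm \<Rightarrow> bool" where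
  "wsat w Bot \<longleftrightarrow> False"
| "wsat w (Eq i j) \<longleftrightarrow> (\<exists>a\<in>set w. i \<in> snd a \<and> j \<in> snd a)"
| "wsat w (Lt i j) \<longleftrightarrow> (\<exists>x a y. w = x @ a # y \<and> i \<in> snd a \<and> (\<exists>b\<in>set y. j \<in> snd b))"
| "wsat w (Pr p i) \<longleftrightarrow> (\<exists>a\<in>set w. p \<in> fst a \<and> i \<in> snd a)"
| "wsat w (Imp \<phi> \<psi>) \<longleftrightarrow> (wsat w \<phi> \<longrightarrow> wsat w \<psi>)"
| "wsat w (All \<phi>) \<longleftrightarrow> (\<forall>i<length w. wsat (mark i w) \<phi>)"

text \<open>Atoms get positive rank, since marks are compared by choosing positions.\<close>

primrec rk :: "fm \<Rightarrow> nat" where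
  "rk Bot = 0"
| "rk (Eq i j) = 1"
| "rk (Lt i j) = 2"
| "rk (Pr p i) = 1"
| "rk (Imp \<phi> \<psi>) = max (rk \<phi>) (rk \<psi>)"
| "rk (All \<phi>) = Suc (rk \<phi>)"

lemma eqv_set:
  assumes "eqv (Suc d) w v"
  shows "set w = set v"
proof -
  have "set w \<subseteq> set v" if wv: "eqv (Suc d) w v" for w v :: "'a list"
  proof
    fix a assume "a \<in> set w"
    then obtain x y where "w = x @ a # y" by (meson split_list)
    with wv obtain x' y' where "v = x' @ a # y'" by (rule eqv_splitE1)
    then show "a \<in> set v" by simp
  qed
  from this[OF assms] this[OF eqv_sym[OF assms]] show ?thesis by (rule equalityI)
qed

lemma mark_split:
  "mark (length x) (x @ a # y) =
    map shift_marks x @ [apsnd (insert 0) (shift_marks a)] @ map shift_marks y"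
  by (simp add: mark_def list_update_append nth_append)

text \<open>Choosing a position is a move of the game. Marking changes the chosen letter in the same
  way on both sides and only relabels the factors, so the congruence puts the pieces together
  again.\<close>

lemma eqv_mark:
  assumes "eqv (Suc d) w v" "i < length w"
  shows "\<exists>j<length v. eqv d (mark i w) (mark j v)"
proof -
  obtain x a y where w: "w = x @ a # y" "i = length x"
    using id_take_nth_drop[OF assms(2)] assms(2) by (metis length_take min.absorb4)
  from assms(1) w(1) obtain x' y' where v: "v = x' @ a # y'" "eqv d x x'" "eqv d y y'"
    by (rule eqv_splitE1)
  then have "eqv d (mark i w) (mark (length x') v)"
    unfolding w v(1) mark_split by (intro eqv_append eqv_map eqv_refl)
  then show ?thesis using v(1) by (intro exI[of _ "length x'"]) simp
qed

text \<open>A quantifier costs one round: by \<open>eqv_mark\<close> each choice of a position in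
  one word has a partner in the other.\<close>

lemma wsat_eqv: "eqv d w v \<Longrightarrow> rk \<phi> \<le> d \<Longrightarrow> wsat w \<phi> \<longleftrightarrow> wsat v \<phi>"
proof (induction \<phi> arbitrary: d w v)
  case (Eq i j)
  then obtain c where "d = Suc c" by (cases d) auto
  with Eq.prems eqv_set[of c w v] show ?case by simp
next
  case (Lt i j)
  then obtain c where d: "d = Suc (Suc c)" by (metis Suc_le_D numeral_2_eq_2 rk.simps(3) Suc_le_mono)
  have "wsat v (Lt i j)" if wv: "eqv d w v" and "wsat w (Lt i j)" for w v
  proof -
    from \<open>wsat w (Lt i j)\<close> obtain x a y b
      where w: "w = x @ a # y" "i \<in> snd a" "b \<in> set y" "j \<in> snd b" by auto
    \<comment> \<open>One round answers the position marked \<open>i\<close>; the remaining one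
      compares the letters to its right. This is why \<open>Lt\<close> has rank 2.\<close>
    obtain x' y' where "v = x' @ a # y'" "eqv (Suc c) y y'"
      using wv[unfolded d] w(1) by (rule eqv_splitE1)
    with w eqv_set[of c y y'] show ?thesis unfolding wsat.simps by blast
  qed
  from this[OF Lt.prems(1)] this[OF eqv_sym[OF Lt.prems(1)]] show ?case by blast
next
  case (Pr p i)
  then obtain c where "d = Suc c" by (cases d) auto
  with Pr.prems eqv_set[of c w v] show ?case by simp
next
  case (Imp \<phi> \<psi>)
  then show ?case by (metis max.bounded_iff rk.simps(5) wsat.simps(5))
next
  case (All \<phi>)
  then obtain c where d: "d = Suc c" "rk \<phi> \<le> c" by (cases d) auto
  have "wsat v (All \<phi>)" if "eqv d v w" and "wsat w (All \<phi>)" for w v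
  proof -
    have "wsat (mark i v) \<phi>" if "i < length v" for i
    proof -
      from eqv_mark[OF \<open>eqv d v w\<close>[unfolded d] that]
      obtain j where "j < length w" "eqv c (mark i v) (mark j w)" by blast
      with All.IH d(2) \<open>wsat w (All \<phi>)\<close> show ?thesis by auto
    qed
    then show ?thesis by simp
  qed
  from this[OF All.prems(1)] this[OF eqv_sym[OF All.prems(1)]] show ?case by blast
qed simp

text \<open>Marks are restricted to a set \<open>V\<close> of variables so that the word of a sentence is unmarked.\<close>

definition marked_word :: "nat struct \<Rightarrow> nat set \<Rightarrow> (nat \<Rightarrow> nat) \<Rightarrow> nat \<Rightarrow> (nat set \<times> nat set) list" where
  "marked_word M V e n = map (\<lambda>i. ({p. pr M p i}, {k\<in>V. e k = i})) [0..<n]"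

lemma mark_marked_word:
  assumes "i < n"
  shows "mark i (marked_word M V e n) =
    marked_word M (insert 0 (Suc ` V)) (case_nat i e) n"
proof -
  have *: "{k \<in> insert 0 (Suc ` V). case_nat i e k = l} =
      (if l = i then insert 0 (Suc ` {k\<in>V. e k = l}) else Suc ` {k\<in>V. e k = l})" for l
    by auto
  have "length (mark i (marked_word M V e n)) = n"
    by (simp add: mark_def marked_word_def)
  moreover have "mark i (marked_word M V e n) ! l = marked_word M (insert 0 (Suc ` V)) (case_nat i e) n ! l"
    if "l < n" for l
    using assms that unfolding marked_word_def *
    by (cases "l = i") (simp_all add: mark_def shift_marks_def)
  ultimately show ?thesis
    by (intro nth_equalityI) (simp_all add: marked_word_def)
qed

text \<open>Each variable in \<open>V\<close> marks exactly one position, namely its value, so the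
  existential clauses of \<open>wsat\<close> for atoms recover the assignment.\<close>

lemma wsat_marked_word:
  assumes M: "univ M = {..<n}" "\<And>i j. i < n \<Longrightarrow> j < n \<Longrightarrow> lt M i j \<longleftrightarrow> i < j"
    and "fvs \<phi> \<subseteq> V" "e ` V \<subseteq> {..<n}"
  shows "wsat (marked_word M V e n) \<phi> \<longleftrightarrow> sat M e \<phi>"
  using assms(3,4)
proof (induction \<phi> arbitrary: V e)
  case (Eq i j)
  then show ?case by (auto simp: marked_word_def)
next
  case (Lt i j)
  let ?w = "marked_word M V e n"
  have w: "length ?w = n" "\<And>l. l < n \<Longrightarrow> snd (?w ! l) = {k\<in>V. e k = l}"
    by (simp_all add: marked_word_def)
  have ij: "i \<in> V" "j \<in> V" "e i < n" "e j < n" using Lt.prems by auto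
  have "e i < e j" if "?w = x @ a # y" "i \<in> snd a" "b \<in> set y" "j \<in> snd b" for x a y b
  proof -
    from that(3) obtain y1 y2 where y: "y = y1 @ b # y2" by (meson split_list)
    have n: "n = length x + Suc (length y)" using arg_cong[OF that(1), of length] w(1) by simp
    have "?w ! length x = a" "?w ! (length x + Suc (length y1)) = b"
      unfolding that(1) y by (simp_all add: nth_append)
    moreover have "length x < n" "length x + Suc (length y1) < n"
      by (simp_all add: n y)
    ultimately have "e i = length x" "e j = length x + Suc (length y1)"
      using that(2,4) w(2)[of "length x"] w(2)[of "length x + Suc (length y1)"] by simp_all
    then show ?thesis by simp
  qed
  moreover have "wsat ?w (Lt i j)" if "e i < e j"
  proof -
    have "?w = take (e i) ?w @ ?w ! e i # drop (Suc (e i)) ?w"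
      using ij w(1) by (metis id_take_nth_drop)
    moreover have "i \<in> snd (?w ! e i)" "j \<in> snd (?w ! e j)" using ij w(2) by auto
    moreover have "?w ! e j \<in> set (drop (Suc (e i)) ?w)"
      using that ij w(1) by (auto simp: in_set_conv_nth intro!: exI[of _ "e j - Suc (e i)"])
    ultimately show ?thesis unfolding wsat.simps by blast
  qed
  ultimately have "wsat ?w (Lt i j) \<longleftrightarrow> e i < e j" unfolding wsat.simps by blast
  then show ?case using M(2) ij by simp
next
  case (Pr p i)
  then show ?case by (auto simp: marked_word_def)
next
  case (All \<phi>)
  have "wsat (mark i (marked_word M V e n)) \<phi> \<longleftrightarrow> sat M (case_nat i e) \<phi>" if "i < n" for i
    unfolding mark_marked_word[OF that]
  proof (rule All.IH)
    show "fvs \<phi> \<subseteq> insert 0 (Suc ` V)"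
    proof
      fix k assume "k \<in> fvs \<phi>"
      with All.prems(1) show "k \<in> insert 0 (Suc ` V)" by (cases k) auto
    qed
    show "case_nat i e ` insert 0 (Suc ` V) \<subseteq> {..<n}"
      using that All.prems(2) by auto
  qed
  moreover have "length (marked_word M V e n) = n" by (simp add: marked_word_def)
  ultimately show ?case using M(1) by auto
qed auto

section \<open>Soundness and the passage from finite models to words\<close>

lemma sat_cong:
  assumes "univ N = univ M" "\<And>a b. a \<in> univ M \<Longrightarrow> b \<in> univ M \<Longrightarrow> lt N a b \<longleftrightarrow> lt M a b"
    and "\<And>p a. p \<in> preds \<phi> \<Longrightarrow> a \<in> univ M \<Longrightarrow> pr N p a \<longleftrightarrow> pr M p a"
    and "\<And>i. i \<in> fvs \<phi> \<Longrightarrow> e' i = e i" "\<And>i. i \<in> fvs \<phi> \<Longrightarrow> e i \<in> univ M"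
  shows "sat N e' \<phi> \<longleftrightarrow> sat M e \<phi>"
  using assms(3-5)
proof (induction \<phi> arbitrary: e e')
  case (Imp \<phi> \<psi>)
  have "sat N e' \<phi> \<longleftrightarrow> sat M e \<phi>" by (rule Imp.IH(1)) (use Imp.prems in auto)
  moreover have "sat N e' \<psi> \<longleftrightarrow> sat M e \<psi>" by (rule Imp.IH(2)) (use Imp.prems in auto)
  ultimately show ?case by simp
next
  case (All \<phi>)
  have "sat N (case_nat a e') \<phi> \<longleftrightarrow> sat M (case_nat a e) \<phi>" if "a \<in> univ M" for a
    by (rule All.IH) (use All.prems that in \<open>auto split: nat.splits\<close>)
  then show ?case using assms(1) by simp
qed (use assms(1,2) in auto)

lemma sat_ren: "sat M e (ren \<rho> \<phi>) \<longleftrightarrow> sat M (e \<circ> \<rho>) \<phi>"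
proof (induction \<phi> arbitrary: e \<rho>)
  case (All \<phi>)
  have "case_nat a e \<circ> case_nat 0 (\<lambda>i. Suc (\<rho> i)) = case_nat a (e \<circ> \<rho>)" for a
    by (auto simp: fun_eq_iff split: nat.splits)
  then show ?case by (simp only: ren.simps sat.simps All.IH)
qed simp_all

lemma sat_inst: "sat M e (inst t \<phi>) \<longleftrightarrow> sat M (case_nat (e t) e) \<phi>"
proof -
  have "e \<circ> case_nat t (\<lambda>i. i) = case_nat (e t) e"
    by (auto simp: fun_eq_iff split: nat.splits)
  then show ?thesis by (simp add: sat_ren)
qed

text \<open>Assignments into the universe are what \<open>AllE\<close> requires: \<open>All\<close>
  ranges over \<open>univ M\<close>, and the instance uses the value \<open>e t\<close>.\<close>

lemma soundness:
  assumes "\<Gamma> \<turnstile> \<phi>" "range e \<subseteq> univ M" "\<And>\<gamma>. \<gamma> \<in> \<Gamma> \<Longrightarrow> sat M e \<gamma>"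
  shows "sat M e \<phi>"
  using assms
proof (induction arbitrary: e rule: derives.induct)
  case (ImpI \<phi> \<Gamma> \<psi>)
  then show ?case by auto
next
  case (ImpE \<Gamma> \<phi> \<psi>)
  then show ?case by simp
next
  case (RAA \<phi> \<Gamma>)
  show ?case
  proof (rule ccontr)
    assume "\<not> sat M e \<phi>"
    then have "sat M e Bot" using RAA by (intro RAA.IH) auto
    then show False by simp
  qed
next
  case (AllI \<Gamma> \<phi>)
  have "sat M (case_nat a e) \<phi>" if "a \<in> univ M" for a
  proof (rule AllI.IH)
    show "range (case_nat a e) \<subseteq> univ M"
      using that AllI.prems(1) by (simp add: image_subset_iff split: nat.split)
    have "case_nat a e \<circ> Suc = e" by auto
    then show "sat M (case_nat a e) \<gamma>" if "\<gamma> \<in> ren Suc ` \<Gamma>" for \<gamma>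
      using that AllI.prems(2) by (auto simp: sat_ren)
  qed
  then show ?case by simp
next
  case (AllE \<Gamma> \<phi> t)
  then have "sat M e (All \<phi>)" by blast
  then show ?case using AllE.prems(1) by (auto simp: sat_inst)
next
  case (EqE \<Gamma> s t \<phi>)
  then have "sat M e (Eq s t)" "sat M e (inst s \<phi>)" by blast+
  then show ?case by (simp add: sat_inst)
qed auto

lemma LIN_model:
  assumes "is_model M \<alpha>" "\<forall>\<phi>\<in>LIN. {\<alpha>} \<turnstile> \<phi>"
  shows "\<And>a. a \<in> univ M \<Longrightarrow> \<not> lt M a a"
    and "\<And>a b c. a \<in> univ M \<Longrightarrow> b \<in> univ M \<Longrightarrow> c \<in> univ M \<Longrightarrow>
      lt M a b \<Longrightarrow> lt M b c \<Longrightarrow> lt M a c"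
    and "\<And>a b. a \<in> univ M \<Longrightarrow> b \<in> univ M \<Longrightarrow> lt M a b \<or> a = b \<or> lt M b a"
proof -
  obtain z where z: "z \<in> univ M" using assms(1) by (auto simp: is_model_def)
  have "sat M (\<lambda>_. z) \<phi>" if "\<phi> \<in> LIN" for \<phi>
    using assms that z by (intro soundness[of "{\<alpha>}" \<phi>]) (auto simp: is_model_def)
  then have "\<forall>\<phi>\<in>LIN. sat M (\<lambda>_. z) \<phi>" by blast
  also have "?this \<longleftrightarrow> (\<forall>a\<in>univ M. \<not> lt M a a) \<and>
      (\<forall>a\<in>univ M. \<forall>b\<in>univ M. \<forall>c\<in>univ M. lt M a b \<longrightarrow> lt M b c \<longrightarrow> lt M a c) \<and>
      (\<forall>a\<in>univ M. \<forall>b\<in>univ M. \<not> lt M a b \<longrightarrow> a \<noteq> b \<longrightarrow> lt M b a)"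
    by (simp add: LIN_def numeral_2_eq_2)
  finally have ax: "\<forall>a\<in>univ M. \<not> lt M a a"
    "\<forall>a\<in>univ M. \<forall>b\<in>univ M. \<forall>c\<in>univ M. lt M a b \<longrightarrow> lt M b c \<longrightarrow> lt M a c"
    "\<forall>a\<in>univ M. \<forall>b\<in>univ M. \<not> lt M a b \<longrightarrow> a \<noteq> b \<longrightarrow> lt M b a"
    by blast+
  from ax(1) show "\<And>a. a \<in> univ M \<Longrightarrow> \<not> lt M a a" by blast
  from ax(2) show "\<And>a b c. a \<in> univ M \<Longrightarrow> b \<in> univ M \<Longrightarrow> c \<in> univ M \<Longrightarrow>
      lt M a b \<Longrightarrow> lt M b c \<Longrightarrow> lt M a c" by blast
  from ax(3) show "\<And>a b. a \<in> univ M \<Longrightarrow> b \<in> univ M \<Longrightarrow> lt M a b \<or> a = b \<or> lt M b a" by blast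
qed

text \<open>An element is sent to the number of its predecessors. This is strictly monotone, hence
  injective, and counting makes it onto.\<close>

lemma finite_linorder_enumeration:
  assumes "finite U"
    and irr: "\<And>a. a \<in> U \<Longrightarrow> \<not> R a a"
    and tr: "\<And>a b c. a \<in> U \<Longrightarrow> b \<in> U \<Longrightarrow> c \<in> U \<Longrightarrow> R a b \<Longrightarrow> R b c \<Longrightarrow> R a c"
    and tot: "\<And>a b. a \<in> U \<Longrightarrow> b \<in> U \<Longrightarrow> R a b \<or> a = b \<or> R b a"
  obtains h where "bij_betw h U {..<card U}" "\<And>a b. a \<in> U \<Longrightarrow> b \<in> U \<Longrightarrow> h a < h b \<longleftrightarrow> R a b"
proof -
  define h where "h a = card {b\<in>U. R b a}" for a
  have mono: "h a < h b" if "a \<in> U" "b \<in> U" "R a b" for a b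
    unfolding h_def
  proof (rule psubset_card_mono)
    have "a \<in> {c\<in>U. R c b}" "a \<notin> {c\<in>U. R c a}" using that irr by auto
    moreover have "{c\<in>U. R c a} \<subseteq> {c\<in>U. R c b}" using that tr by blast
    ultimately show "{c\<in>U. R c a} \<subset> {c\<in>U. R c b}" by blast
  qed (use assms(1) in simp)
  have less: "h a < h b \<longleftrightarrow> R a b" if "a \<in> U" "b \<in> U" for a b
    using mono[of a b] mono[of b a] tot[of a b] that by fastforce
  have inj: "inj_on h U"
    using less irr tot by (intro inj_onI) (metis less_irrefl)
  have "h ` U \<subseteq> {..<card U}"
  proof -
    have "h a < card U" if "a \<in> U" for a
      unfolding h_def using that irr assms(1) by (intro psubset_card_mono) auto
    then show ?thesis by auto
  qed
  moreover have "card (h ` U) = card {..<card U}"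
    using inj by (simp add: card_image)
  ultimately have "h ` U = {..<card U}"
    by (intro card_subset_eq) simp_all
  with inj have "bij_betw h U {..<card U}" by (simp add: bij_betw_def)
  then show thesis using less by (rule that)
qed

definition word_struct :: "nat list \<Rightarrow> nat struct" where
  "word_struct u = \<lparr>univ = {..<length u}, lt = (<), pr = \<lambda>p i. p \<in> set_decode (u ! i)\<rparr>"

text \<open>All predicates are packed into the single number \<open>m\<close>, so that a bounded
  quantifier over numbers can search through structures.\<close>

definition num_struct :: "nat \<Rightarrow> nat \<Rightarrow> nat struct" where
  "num_struct n m = \<lparr>univ = {..<n}, lt = (<), pr = \<lambda>p a. prod_encode (p, a) \<in> set_decode m\<rparr>"

lemma finite_model_word:
  assumes fin: "has_finite_model \<alpha>" and LIN: "\<forall>\<phi>\<in>LIN. {\<alpha>} \<turnstile> \<phi>"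
    and cl: "fvs \<alpha> = {}" and preds: "preds \<alpha> \<subseteq> {..<k}"
  obtains u where "u \<noteq> []" "set u \<subseteq> {..<2 ^ k}" "sat (word_struct u) (\<lambda>_. 0) \<alpha>"
proof -
  obtain M :: "nat struct" where M: "finite (univ M)" "is_model M \<alpha>"
    using fin by (auto simp: has_finite_model_def)
  obtain z where z: "z \<in> univ M" using M(2) by (auto simp: is_model_def)
  note ord = LIN_model[OF M(2) LIN]
  obtain h where h: "bij_betw h (univ M) {..<card (univ M)}"
    "\<And>a b. a \<in> univ M \<Longrightarrow> b \<in> univ M \<Longrightarrow> h a < h b \<longleftrightarrow> lt M a b"
    by (rule finite_linorder_enumeration[of "univ M" "lt M"]) (use M(1) ord in blast)+
  define g where "g = inv_into (univ M) h"
  have g: "g (h a) = a" if "a \<in> univ M" for a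
    using h(1) that by (simp add: g_def bij_betw_def)
  define N where "N = \<lparr>univ = {..<card (univ M)}, lt = (<), pr = \<lambda>p i. pr M p (g i)\<rparr>"
  have "sat N (h \<circ> (\<lambda>_. z)) \<alpha> \<longleftrightarrow> sat M (\<lambda>_. z) \<alpha>"
    using h z by (intro sat_transfer) (auto simp: N_def g)
  then have N: "sat N (h \<circ> (\<lambda>_. z)) \<alpha>" using M(2) z by (auto simp: is_model_def)
  \<comment> \<open>Letters record the predicates of \<alpha> only, which makes them finite sets
    with codes below \<open>2 ^ k\<close>.\<close>
  define u where "u = map (\<lambda>i. set_encode {p\<in>preds \<alpha>. pr N p i}) [0..<card (univ M)]"
  have fin: "finite {p\<in>preds \<alpha>. pr N p i}" for i
    using preds by (auto intro: finite_subset)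
  have "sat (word_struct u) (\<lambda>_. 0) \<alpha> \<longleftrightarrow> sat N (h \<circ> (\<lambda>_. z)) \<alpha>"
    using cl by (intro sat_cong) (auto simp: word_struct_def N_def u_def fin[unfolded N_def, simplified])
  moreover have "set u \<subseteq> {..<2 ^ k}"
    using preds by (auto simp: u_def intro!: set_encode_less)
  moreover have "u \<noteq> []"
    using M(1) z by (auto simp: u_def card_eq_0_iff)
  ultimately show thesis using N that by blast
qed

lemma wsat_word:
  assumes "fvs \<phi> = {}"
  shows "wsat (map (\<lambda>a. (set_decode a, {})) u) \<phi> \<longleftrightarrow> sat (word_struct u) e \<phi>"
proof -
  have "marked_word (word_struct u) {} e (length u) = map (\<lambda>a. (set_decode a, {})) u"
    by (intro nth_equalityI) (auto simp: marked_word_def word_struct_def)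
  moreover have "wsat (marked_word (word_struct u) {} e (length u)) \<phi> \<longleftrightarrow> sat (word_struct u) e \<phi>"
    using assms by (intro wsat_marked_word) (auto simp: word_struct_def)
  ultimately show ?thesis by simp
qed

text \<open>Shortening takes place in words of numbers, where \<open>tp\<close> is defined, and is
  carried over to decoded letters by \<open>eqv_map\<close>. It is repeated until the bound is
  met.\<close>

lemma ex_small_word:
  assumes "u \<noteq> []" "set u \<subseteq> {..<A}" "wsat (map f u) \<phi>" "rk \<phi> \<le> d"
  shows "\<exists>v. v \<noteq> [] \<and> length v \<le> tp_bound A d \<and> wsat (map f v) \<phi>"
  using assms(1-3)
proof (induction u rule: length_induct)
  case (1 u)
  show ?case
  proof (cases "length u \<le> tp_bound A d")
    case False
    then obtain v where v: "v \<noteq> []" "length v < length u" "set v \<subseteq> set u" "eqv d u v"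
      using ex_shorter_eqv[OF "1.prems"(2), of d] by auto
    have "wsat (map f v) \<phi>"
      using wsat_eqv[OF eqv_map[OF v(4)] assms(4)] "1.prems"(3) by simp
    moreover have "set v \<subseteq> {..<A}" using v(3) "1.prems"(2) by simp
    ultimately show ?thesis using "1.IH" v(1,2) by blast
  qed (use "1.prems" in blast)
qed

section \<open>Bounded search for a model\<close>

text \<open>A positive tag \<open>a\<close> makes the code strictly exceed its content
  \<open>b\<close>. Termination of the decoder and the room for another digit in truth tables rest
  on this.\<close>

lemma le_prod_encode: "2 * a + b \<le> prod_encode (a, b)"
proof -
  have "n \<le> triangle n" for n by (induction n) auto
  from this[of "a + b"] show ?thesis by (simp add: prod_encode_def)
qed

lemma prod_decode_le: "(a, b) = prod_decode c \<Longrightarrow> 2 * a + b \<le> c"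
  by (metis le_prod_encode prod_decode_inverse)

text \<open>Allows the search bound to use the code in place of the rank.\<close>

lemma rk_le_godel: "rk \<phi> \<le> godel \<phi>"
proof (induction \<phi>)
  case (Eq i j)
  then show ?case using le_prod_encode[of 1 "prod_encode (i, j)"] by simp
next
  case (Lt i j)
  then show ?case using le_prod_encode[of 2 "prod_encode (i, j)"] by simp
next
  case (Pr p i)
  then show ?case using le_prod_encode[of 3 "prod_encode (p, i)"] by simp
next
  case (Imp \<phi> \<psi>)
  then show ?case
    using le_prod_encode[of 4 "prod_encode (godel \<phi>, godel \<psi>)"]
      le_prod_encode[of "godel \<phi>" "godel \<psi>"] by simp
next
  case (All \<phi>)
  then show ?case using le_prod_encode[of 5 "godel \<phi>"] by simp
qed simp

text \<open>Bounds the alphabet: for a sentence with code \<open>g\<close>, letters below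
  \<open>2 ^ Suc g\<close> suffice.\<close>

lemma preds_le_godel: "p \<in> preds \<phi> \<Longrightarrow> p \<le> godel \<phi>"
proof (induction \<phi>)
  case (Pr q i)
  then show ?case
    using le_prod_encode[of 3 "prod_encode (q, i)"] le_prod_encode[of q i] by simp
next
  case (Imp \<phi> \<psi>)
  then show ?case
    using le_prod_encode[of 4 "prod_encode (godel \<phi>, godel \<psi>)"]
      le_prod_encode[of "godel \<phi>" "godel \<psi>"] by auto
next
  case (All \<phi>)
  then show ?case using le_prod_encode[of 5 "godel \<phi>"] by simp
qed simp_all

text \<open>
  A left inverse of \<open>godel\<close>. The truth table below is constrained at every number of the form
  \<open>prod_encode (4, _)\<close> or \<open>prod_encode (5, _)\<close>, code or not, so its existence needs a decoding
  that commutes with these constructors everywhere.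
\<close>

function fm_of :: "nat \<Rightarrow> fm" where
  "fm_of c = (case prod_decode c of (t, r) \<Rightarrow> case prod_decode r of (x, y) \<Rightarrow>
    if t = 1 then Eq x y
    else if t = 2 then Lt x y
    else if t = 3 then Pr x y
    else if t = 4 then Imp (fm_of x) (fm_of y)
    else if t = 5 then All (fm_of r)
    else Bot)"
  by auto
termination
  by (relation "measure id") (auto dest!: prod_decode_le)

declare fm_of.simps [simp del]

lemma fm_of_prod_encode:
  "fm_of (prod_encode (0, x)) = Bot"
  "fm_of (prod_encode (Suc 0, prod_encode (x, y))) = Eq x y"
  "fm_of (prod_encode (2, prod_encode (x, y))) = Lt x y"
  "fm_of (prod_encode (3, prod_encode (x, y))) = Pr x y"
  "fm_of (prod_encode (4, prod_encode (x, y))) = Imp (fm_of x) (fm_of y)"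
  "fm_of (prod_encode (5, x)) = All (fm_of x)"
  by (subst fm_of.simps, simp split: prod.split)+

text \<open>The assignment with code \<open>e\<close> lists the base \<open>n\<close> digits of \<open>e\<close>.\<close>

definition digit :: "nat \<Rightarrow> nat \<Rightarrow> nat \<Rightarrow> nat" where
  "digit n e i = e div n ^ i mod n"

text \<open>Binding a variable prepends a least significant digit; the other digits move up one
  place, just as de Bruijn indices do.\<close>

lemma digit_push: "a < n \<Longrightarrow> digit n (a + n * e) = case_nat a (digit n e)"
  by (auto simp: digit_def fun_eq_iff div_mult2_eq split: nat.splits)

lemma push_less_power:
  fixes a e n k :: nat
  assumes "a < n" "e < n ^ k"
  shows "a + n * e < n ^ Suc k"
proof -
  have "a + n * e < n * Suc e" using assms(1) by simp
  also have "\<dots> \<le> n * n ^ k" using assms(2) by (intro mult_le_mono2) simp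
  finally show ?thesis by simp
qed

text \<open>
  \<open>T\<close> codes the set of all pairs of a formula code \<open>c\<close> and an assignment code \<open>e\<close> such that \<open>c\<close>
  holds under \<open>e\<close>. A code \<open>c\<close> is only considered under assignments with at most \<open>g - c\<close> digits;
  this leaves room for a further digit when a quantifier is removed, as \<open>c\<close> then decreases.
\<close>

definition truth_table :: "nat \<Rightarrow> nat \<Rightarrow> nat \<Rightarrow> nat \<Rightarrow> bool" where
  "truth_table g n m T \<longleftrightarrow>
    (\<forall>c<Suc g. \<forall>e<n ^ (g - c). \<forall>x<Suc g. \<forall>y<Suc g.
      (c = prod_encode (0, 0) \<longrightarrow> prod_encode (c, e) \<notin> set_decode T) \<and>
      (c = prod_encode (1, prod_encode (x, y)) \<longrightarrow>
        (prod_encode (c, e) \<in> set_decode T \<longleftrightarrow> digit n e x = digit n e y)) \<and>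
      (c = prod_encode (2, prod_encode (x, y)) \<longrightarrow>
        (prod_encode (c, e) \<in> set_decode T \<longleftrightarrow> digit n e x < digit n e y)) \<and>
      (c = prod_encode (3, prod_encode (x, y)) \<longrightarrow>
        (prod_encode (c, e) \<in> set_decode T \<longleftrightarrow> prod_encode (x, digit n e y) \<in> set_decode m)) \<and>
      (c = prod_encode (4, prod_encode (x, y)) \<longrightarrow>
        (prod_encode (c, e) \<in> set_decode T \<longleftrightarrow>
          (prod_encode (x, e) \<in> set_decode T \<longrightarrow> prod_encode (y, e) \<in> set_decode T))) \<and>
      (c = prod_encode (5, x) \<longrightarrow>
        (prod_encode (c, e) \<in> set_decode T \<longleftrightarrow>
          (\<forall>a<n. prod_encode (x, a + n * e) \<in> set_decode T))))"

lemma truth_table_correct: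
  assumes T: "truth_table g n m T" and "0 < n" "godel \<phi> \<le> g" "e < n ^ (g - godel \<phi>)"
  shows "prod_encode (godel \<phi>, e) \<in> set_decode T \<longleftrightarrow> sat (num_struct n m) (digit n e) \<phi>"
  using assms(3,4)
proof (induction \<phi> arbitrary: e)
  case Bot
  then show ?case using T unfolding truth_table_def by (auto simp: less_Suc_eq_le)
next
  case (Eq i j)
  \<comment> \<open>The table constrains components \<open>x\<close> and \<open>y\<close> up to
    \<open>g\<close> only, so the indices must be shown to lie in that range.\<close>
  moreover have "i \<le> g" "j \<le> g"
    using Eq.prems(1) le_prod_encode[of 1 "prod_encode (i, j)"] le_prod_encode[of i j] by simp_all
  ultimately show ?case
    using T[unfolded truth_table_def, rule_format, of "godel (Eq i j)" e i j]
    by (simp add: less_Suc_eq_le)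
next
  case (Lt i j)
  moreover have "i \<le> g" "j \<le> g"
    using Lt.prems(1) le_prod_encode[of 2 "prod_encode (i, j)"] le_prod_encode[of i j] by simp_all
  ultimately show ?case
    using T[unfolded truth_table_def, rule_format, of "godel (Lt i j)" e i j]
    by (simp add: less_Suc_eq_le num_struct_def)
next
  case (Pr p i)
  moreover have "p \<le> g" "i \<le> g"
    using Pr.prems(1) le_prod_encode[of 3 "prod_encode (p, i)"] le_prod_encode[of p i] by simp_all
  ultimately show ?case
    using T[unfolded truth_table_def, rule_format, of "godel (Pr p i)" e p i]
    by (simp add: less_Suc_eq_le num_struct_def)
next
  case (Imp \<phi> \<psi>)
  have le: "godel \<phi> \<le> godel (Imp \<phi> \<psi>)" "godel \<psi> \<le> godel (Imp \<phi> \<psi>)"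
    using le_prod_encode[of 4 "prod_encode (godel \<phi>, godel \<psi>)"]
      le_prod_encode[of "godel \<phi>" "godel \<psi>"] by simp_all
  have "n ^ (g - godel (Imp \<phi> \<psi>)) \<le> n ^ (g - godel \<phi>)" "n ^ (g - godel (Imp \<phi> \<psi>)) \<le> n ^ (g - godel \<psi>)"
    using le \<open>0 < n\<close> by (intro power_increasing; simp)+
  with le Imp.prems Imp.IH[of e]
  have "prod_encode (godel \<phi>, e) \<in> set_decode T \<longleftrightarrow> sat (num_struct n m) (digit n e) \<phi>"
    "prod_encode (godel \<psi>, e) \<in> set_decode T \<longleftrightarrow> sat (num_struct n m) (digit n e) \<psi>"
    by linarith+
  moreover have "godel \<phi> \<le> g" "godel \<psi> \<le> g" using le Imp.prems(1) by linarith+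
  ultimately show ?case
    using T[unfolded truth_table_def, rule_format, of "godel (Imp \<phi> \<psi>)" e "godel \<phi>" "godel \<psi>"] Imp.prems
    by (simp add: less_Suc_eq_le)
next
  case (All \<phi>)
  have less: "godel \<phi> < godel (All \<phi>)"
    using le_prod_encode[of 5 "godel \<phi>"] by simp
  have "prod_encode (godel \<phi>, a + n * e) \<in> set_decode T \<longleftrightarrow>
      sat (num_struct n m) (case_nat a (digit n e)) \<phi>" if "a < n" for a
    unfolding digit_push[OF that, symmetric]
  proof (rule All.IH)
    show "godel \<phi> \<le> g" using less All.prems(1) by linarith
    have "a + n * e < n ^ Suc (g - godel (All \<phi>))"
      using that All.prems(2) by (rule push_less_power)
    also have "\<dots> \<le> n ^ (g - godel \<phi>)"
      using less All.prems(1) \<open>0 < n\<close> by (intro power_increasing) linarith+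
    finally show "a + n * e < n ^ (g - godel \<phi>)" .
  qed
  moreover have "godel \<phi> \<le> g" using less All.prems(1) by linarith
  ultimately show ?case
    using T[unfolded truth_table_def, rule_format, of "godel (All \<phi>)" e "godel \<phi>" 0] All.prems
    by (simp add: less_Suc_eq_le num_struct_def Ball_def)
qed

lemma ex_truth_table:
  assumes "0 < n"
  shows "\<exists>T<2 ^ Suc (prod_encode (g, n ^ g)). truth_table g n m T"
proof -
  let ?M = "num_struct n m"
  \<comment> \<open>The witness evaluates every number up to \<open>g\<close>, whether a formula
    code or not, by way of \<open>fm_of\<close>.\<close>
  define X where "X = (\<lambda>(c, e). prod_encode (c, e)) `
    {(c, e). c \<le> g \<and> e < n ^ g \<and> sat ?M (digit n e) (fm_of c)}"
  have X: "prod_encode (c, e) \<in> X \<longleftrightarrow> c \<le> g \<and> e < n ^ g \<and> sat ?M (digit n e) (fm_of c)" for c e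
    by (auto simp: X_def)
  have "X \<subseteq> {..<Suc (prod_encode (g, n ^ g))}"
    by (auto simp: X_def less_Suc_eq_le intro!: prod_encode_mono)
  then have "set_encode X < 2 ^ Suc (prod_encode (g, n ^ g))" "finite X"
    by (rule set_encode_less, auto intro: finite_subset)
  moreover have "truth_table g n m (set_encode X)"
    unfolding truth_table_def set_encode_inverse[OF \<open>finite X\<close>]
  proof (intro allI impI)
    fix c e x y assume c: "c < Suc g" "e < n ^ (g - c)"
    have "n ^ (g - c) \<le> n ^ g" using assms by (intro power_increasing) simp_all
    then have e: "e < n ^ g" using c(2) by linarith
    \<comment> \<open>A number with tag 5 is positive, hence \<open>Suc (g - c)\<close> is at most
      \<open>g\<close> and the longer assignment still lies within the table.\<close>
    have push: "a + n * e < n ^ g" if "c = prod_encode (5, x)" "a < n" for a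
    proof -
      have "a + n * e < n ^ Suc (g - c)" using that(2) c(2) by (rule push_less_power)
      also have "\<dots> \<le> n ^ g"
        using that(1) le_prod_encode[of 5 x] c(1) assms by (intro power_increasing) linarith+
      finally show ?thesis .
    qed
    have le4: "x \<le> g" "y \<le> g" if "c = prod_encode (4, prod_encode (x, y))"
      using that le_prod_encode[of 4 "prod_encode (x, y)"] le_prod_encode[of x y] c(1) by linarith+
    have le5: "x \<le> g" if "c = prod_encode (5, x)"
      using that le_prod_encode[of 5 x] c(1) by linarith
    show "(c = prod_encode (0, 0) \<longrightarrow> prod_encode (c, e) \<notin> X) \<and>
      (c = prod_encode (1, prod_encode (x, y)) \<longrightarrow>
        (prod_encode (c, e) \<in> X \<longleftrightarrow> digit n e x = digit n e y)) \<and>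
      (c = prod_encode (2, prod_encode (x, y)) \<longrightarrow>
        (prod_encode (c, e) \<in> X \<longleftrightarrow> digit n e x < digit n e y)) \<and>
      (c = prod_encode (3, prod_encode (x, y)) \<longrightarrow>
        (prod_encode (c, e) \<in> X \<longleftrightarrow> prod_encode (x, digit n e y) \<in> set_decode m)) \<and>
      (c = prod_encode (4, prod_encode (x, y)) \<longrightarrow>
        (prod_encode (c, e) \<in> X \<longleftrightarrow> (prod_encode (x, e) \<in> X \<longrightarrow> prod_encode (y, e) \<in> X))) \<and>
      (c = prod_encode (5, x) \<longrightarrow>
        (prod_encode (c, e) \<in> X \<longleftrightarrow> (\<forall>a<n. prod_encode (x, a + n * e) \<in> X)))"
    proof (intro conjI impI)
      assume "c = prod_encode (4, prod_encode (x, y))"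
      then show "prod_encode (c, e) \<in> X \<longleftrightarrow> (prod_encode (x, e) \<in> X \<longrightarrow> prod_encode (y, e) \<in> X)"
        using c(1) e le4 by (simp add: X fm_of_prod_encode)
    next
      assume "c = prod_encode (5, x)"
      then show "prod_encode (c, e) \<in> X \<longleftrightarrow> (\<forall>a<n. prod_encode (x, a + n * e) \<in> X)"
        using c(1) e le5 push by (simp add: X fm_of_prod_encode digit_push) (auto simp: num_struct_def)
    qed (use c(1) e in \<open>simp_all add: X fm_of_prod_encode num_struct_def\<close>)
  qed
  ultimately show ?thesis by blast
qed

text \<open>\<open>g\<close> stands in for the rank, and \<open>2 ^ Suc g\<close> bounds the
  alphabet. The bounds on \<open>m\<close> and \<open>T\<close> are those for sets of pairs with
  components at most \<open>g\<close> and \<open>n\<close>, respectively \<open>g\<close> and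
  \<open>n ^ g\<close>.\<close>

definition small_model :: "nat \<Rightarrow> bool" where
  "small_model g \<longleftrightarrow>
    (\<exists>n<Suc (tp_bound (2 ^ Suc g) g). 0 < n \<and>
      (\<exists>m<2 ^ Suc (prod_encode (g, n)). \<exists>T<2 ^ Suc (prod_encode (g, n ^ g)).
        truth_table g n m T \<and> prod_encode (g, 0) \<in> set_decode T))"

text \<open>Unfolding leaves bounded quantifiers, connectives, arithmetic, bit tests and
  \<open>rec_nat\<close>, each covered by a closure rule.\<close>

lemma decidable_small_model: "decidable (Suc 0) (\<lambda>e. small_model (e 0))"
  unfolding small_model_def truth_table_def digit_def tp_bound_def
  by (intro recursive_intros)

lemma has_finite_model_iff_small_model:
  assumes cl: "fvs \<alpha> = {}" and LIN: "\<forall>\<phi>\<in>LIN. {\<alpha>} \<turnstile> \<phi>"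
  shows "has_finite_model \<alpha> \<longleftrightarrow> small_model (godel \<alpha>)"
proof
  let ?g = "godel \<alpha>"
  assume "has_finite_model \<alpha>"
  then obtain u where u: "u \<noteq> []" "set u \<subseteq> {..<2 ^ Suc ?g}" "sat (word_struct u) (\<lambda>_. 0) \<alpha>"
    using finite_model_word[OF _ LIN cl, of "Suc ?g"] preds_le_godel
    by (auto simp: less_Suc_eq_le subset_iff)
  let ?f = "\<lambda>a. (set_decode a, {})"
  have "wsat (map ?f u) \<alpha>" using u(3) wsat_word[OF cl] by blast
  then obtain v where v: "v \<noteq> []" "length v \<le> tp_bound (2 ^ Suc ?g) ?g" "wsat (map ?f v) \<alpha>"
    using ex_small_word[OF u(1,2) _ rk_le_godel] by blast
  define n where "n = length v"
  define X where "X = (\<lambda>(p, i). prod_encode (p, i)) ` {(p, i). p \<le> ?g \<and> i < n \<and> p \<in> set_decode (v ! i)}"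
  define m where "m = set_encode X"
  have "X \<subseteq> {..<Suc (prod_encode (?g, n))}"
    by (auto simp: X_def less_Suc_eq_le intro!: prod_encode_mono)
  then have m: "m < 2 ^ Suc (prod_encode (?g, n))" and "finite X"
    unfolding m_def by (rule set_encode_less, auto intro: finite_subset)
  then have "set_decode m = X" by (simp add: m_def)
  \<comment> \<open>The structures may differ on predicates beyond \<open>?g\<close>, but none of
    these occurs in \<alpha>; a sentence also ignores the assignment.\<close>
  then have "sat (num_struct n m) (digit n 0) \<alpha> \<longleftrightarrow> sat (word_struct v) (\<lambda>_. 0) \<alpha>"
    using cl by (intro sat_cong) (auto simp: num_struct_def word_struct_def n_def X_def preds_le_godel)
  then have sat: "sat (num_struct n m) (digit n 0) \<alpha>" using v(3) wsat_word[OF cl] by blast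
  have n: "0 < n" using v(1) by (simp add: n_def)
  then obtain T where T: "T < 2 ^ Suc (prod_encode (?g, n ^ ?g))" "truth_table ?g n m T"
    using ex_truth_table by blast
  \<comment> \<open>At code \<open>?g\<close> no digits are left, and 0 is the only assignment code
    below \<open>n ^ 0\<close>.\<close>
  then have "prod_encode (?g, 0) \<in> set_decode T"
    using truth_table_correct[OF T(2) n, of \<alpha> 0] sat by simp
  moreover have "n < Suc (tp_bound (2 ^ Suc ?g) ?g)" using v(2) by (simp add: n_def)
  ultimately show "small_model ?g"
    unfolding small_model_def using n m T by blast
next
  assume "small_model (godel \<alpha>)"
  then obtain n m T where n: "0 < n" and T: "truth_table (godel \<alpha>) n m T"
    "prod_encode (godel \<alpha>, 0) \<in> set_decode T"
    by (auto simp: small_model_def)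
  then have "sat (num_struct n m) (digit n 0) \<alpha>"
    using truth_table_correct[OF T(1) n, of \<alpha> 0] by simp
  moreover have "sat (num_struct n m) e \<alpha> \<longleftrightarrow> sat (num_struct n m) (digit n 0) \<alpha>" for e
    using cl by (intro sat_cong) auto
  ultimately have "is_model (num_struct n m) \<alpha>"
    using n by (auto simp: is_model_def num_struct_def)
  then show "has_finite_model \<alpha>"
    unfolding has_finite_model_def by (intro exI[of _ "num_struct n m"]) (simp add: num_struct_def)
qed

theorem corollary5p5:
  shows "decidable_on godel
    {\<alpha>. (\<exists>S. finite S \<and> \<alpha> \<in> sentences S) \<and> (\<forall>\<phi>\<in>LIN. {\<alpha>} \<turnstile> \<phi>)}
    has_finite_model"
proof -
  obtain f where f: "\<And>xs. length xs = Suc 0 \<Longrightarrow> computes f xs (if small_model (arg xs 0) then 1 else 0)"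
    using decidable_small_model unfolding decidable_def recursive_def by blast
  have "computes f [g] (if small_model g then 1 else 0)" for g
    using f[of "[g]"] by (simp add: arg_Cons)
  then have "computes f [godel \<alpha>] (if has_finite_model \<alpha> then 1 else 0)"
    if "fvs \<alpha> = {}" "\<forall>\<phi>\<in>LIN. {\<alpha>} \<turnstile> \<phi>" for \<alpha>
    unfolding has_finite_model_iff_small_model[OF that] .
  then show ?thesis
    unfolding decidable_on_def sentences_def by blast
qed

end
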